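(* Let $n,m,d\ge1$ be integers, let $\mathbf{\Phi}_1,\dots,\mathbf{\Phi}_d\in\mathbb{C}^{n\times m}$ be matrices all of whose columns have unit 2-norm, and define $\varphi:\mathbb{C}^{m\times d}\to\mathbb{C}^{n\times d}$ by $\varphi(\mathbf{Z})=[\mathbf{\Phi}_1Z_1,\dots,\mathbf{\Phi}_dZ_d]$, where $Z_j$ is the $j$th column of $\mathbf{Z}$. Let $\mathcal{L}$ be a linear map on $\mathbb{C}^{m\times d}$. Let $\mathbf{X}\in\mathbb{C}^{m\times d}$ satisfy $\mathcal{L}\mathbf{X}=0$ and have sparsity $s\ge1$ (that is, exactly $s$ nonzero rows), let $\mathbf{E}\in\mathbb{C}^{n\times d}$, and put $\mathbf{Y}=\varphi(\mathbf{X})+\mathbf{E}$ and $\varepsilon=\|\mathbf{E}\|_{2,2}$. Let $\mu_{\max}=\max_j\mu(\mathbf{\Phi}_j)>0$, where $\mu$ is the mutual coherence, and let $X_{\min}=\min_{k\in\mathrm{supp}(\mathbf{X})}\|\mathrm{row}_k(\mathbf{X})\|_1$. Suppose that $$s<\frac12\Big(1+\frac1{\mu_{\max}}\Big)-\frac{\sqrt{d}\,\varepsilon}{\mu_{\max}X_{\min}} .$$ (i) Let $\mathbf{Z}$ be the output of Algorithm 1 (OMP for joint sparsity, described in the context) applied to $\{\mathbf{\Phi}_j\}$ and $\mathbf{Y}$, with the stopping rule that the residual drops to the level $\varepsilon$ or below (in the algorithm: $\sum_{j=1}^d\|R^k_j\|_2\le\varepsilon$). Then $\mathrm{supp}(\mathbf{Z})=\mathrm{supp}(\mathbf{X})$.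 (ii) Let $\hat{\mathbf{X}}$ solve the least squares problem $$\hat{\mathbf{X}}=\arg\min_{\mathbf{B}\in\mathbb{C}^{m\times d}}\|\mathbf{Y}-\varphi(\mathbf{B})\|_{2,2}\quad\text{subject to}\quad\mathrm{supp}(\mathbf{B})\subseteq\mathrm{supp}(\mathbf{X}),\quad\mathcal{L}\mathbf{B}=0 .$$ Then $$\|\hat{\mathbf{X}}-\mathbf{X}\|_{2,2}\le\frac{2\varepsilon}{\sqrt{1-\mu_{\max}(s-1)}} .$$
   Context: $\mathrm{row}_k(\mathbf{X})$ is the $k$th row of $\mathbf{X}$; $\mathrm{supp}(\mathbf{X})$ is the set of indices of the nonzero rows of $\mathbf{X}$; $\|\cdot\|_{2,2}$ is the Frobenius norm; $\|\cdot\|_1$ and $\|\cdot\|_2$ are the $\ell^1$ and $\ell^2$ norms of a vector. The mutual coherence of a matrix $\mathbf{\Phi}$ with nonzero columns $\Phi_1,\dots,\Phi_m$ is $\mu(\mathbf{\Phi})=\max_{i\ne j}\frac{|\Phi_i^*\Phi_j|}{\|\Phi_i\|_2\|\Phi_j\|_2}$, where $*$ denotes conjugate transpose. Algorithm 1 (OMP for joint sparsity). Denote by $\Phi_{j,i}$ the $i$th column of $\mathbf{\Phi}_j$ and by $R^k_j$ the $j$th column of the residual $\mathbf{R}^k\in\mathbb{C}^{n\times d}$. Initialize $\mathbf{X}^0=0$, $\mathbf{R}^0=\mathbf{Y}$, $\mathcal{S}^0=\emptyset$. For $k=1,2,\dots$: 1) set $i_{\max}=\arg\max_{i}\sum_{j=1}^d|\Phi_{j,i}^*R^{k-1}_j|$;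 2) set $\mathcal{S}^k=\mathcal{S}^{k-1}\cup\{i_{\max}\}$; 3) set $\mathbf{X}^k=\arg\min\|\varphi(\mathbf{Z})-\mathbf{Y}\|_{2,2}$ over $\mathbf{Z}\in\mathbb{C}^{m\times d}$ with $\mathrm{supp}(\mathbf{Z})\subseteq\mathcal{S}^k$; 4) set $\mathbf{R}^k=\mathbf{Y}-\varphi(\mathbf{X}^k)$; 5) stop if $\sum_{j=1}^d\|R^k_j\|_2\le\varepsilon$. Output: $\mathbf{X}^k$. The linear constraint $\mathcal{L}$ is not enforced in the algorithm.
   Formalization: In (i) the test Σ_j‖R^k_j‖_2 ≤ ε with ε = ‖E‖_{2,2} makes the claim false for d ≥ 2; it is replaced by ‖R^k‖_{2,2} ≤ ε, and by Σ_j‖R^k_j‖_2 ≤ τ for every τ with Σ_j‖E_j‖_2 ≤ τ ≤ √d·ε. *)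

theory Defs
  imports "HOL-Analysis.Analysis"
begin

text \<open>
  An \<open>n \<times> m\<close> complex matrix has type \<open>complex^'m^'n\<close>. The library \<open>norm\<close> on this type is the
  \<open>\<ell>\<^sup>2\<close> norm of the \<open>\<ell>\<^sup>2\<close> norms of the rows, i.e. the Frobenius norm; on \<open>complex^'n\<close> it is the
  \<open>\<ell>\<^sup>2\<close> norm.
\<close>

definition cdot :: "complex^'n \<Rightarrow> complex^'n \<Rightarrow> complex" where
  "cdot u v = (\<Sum>l\<in>UNIV. cnj (u $ l) * v $ l)"

definition l1_norm :: "complex^'n \<Rightarrow> real" where
  "l1_norm v = (\<Sum>l\<in>UNIV. norm (v $ l))"

definition row_supp :: "complex^'d^'m \<Rightarrow> 'm set" where
  "row_supp X = {k. row k X \<noteq> 0}"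

definition mat_scale :: "complex \<Rightarrow> complex^'d^'m \<Rightarrow> complex^'d^'m" where
  "mat_scale c Z = (\<chi> k j. c * Z $ k $ j)"

lemma vector_space_mat_scale: "vector_space mat_scale"
  by unfold_locales (simp_all add: mat_scale_def vec_eq_iff algebra_simps)

text \<open>
  Inserting \<open>0\<close> only fixes the value for a one-column matrix, where there is no pair \<open>i \<noteq> j\<close>;
  all other members are nonnegative.
\<close>

definition mutual_coherence :: "complex^'m^'n \<Rightarrow> real" where
  "mutual_coherence A = Max (insert 0
     {norm (cdot (column i A) (column j A)) / (norm (column i A) * norm (column j A)) | i j. i \<noteq> j})"

definition max_coherence :: "('d::finite \<Rightarrow> complex^'m^'n) \<Rightarrow> real" where
  "max_coherence \<Phi> = Max (range (\<lambda>j. mutual_coherence (\<Phi> j)))"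

definition min_row_l1 :: "complex^'d^'m \<Rightarrow> real" where
  "min_row_l1 X = Min ((\<lambda>k. l1_norm (row k X)) ` row_supp X)"

definition phi :: "('d \<Rightarrow> complex^'m^'n) \<Rightarrow> complex^'d^'m \<Rightarrow> complex^'d^'n" where
  "phi \<Phi> Z = (\<chi> l j. (\<Phi> j *v column j Z) $ l)"

definition sum_col_norms :: "complex^'d^'n \<Rightarrow> real" where
  "sum_col_norms R = (\<Sum>j\<in>UNIV. norm (column j R))"

text \<open>
  The sequences \<open>S\<close>, \<open>X\<close>, \<open>R\<close> are continued past the stopping time; stopping is imposed in
  \<open>omp_output\<close>. Ties in either optimization may be broken arbitrarily.
\<close>

definition omp_iterates ::
  "('d \<Rightarrow> complex^'m^'n) \<Rightarrow> complex^'d^'n \<Rightarrow>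
   (nat \<Rightarrow> 'm set) \<Rightarrow> (nat \<Rightarrow> complex^'d^'m) \<Rightarrow> (nat \<Rightarrow> complex^'d^'n) \<Rightarrow> bool" where
  "omp_iterates \<Phi> Y S X R \<longleftrightarrow>
     S 0 = {} \<and> X 0 = 0 \<and> R 0 = Y \<and>
     (\<forall>k.
        (\<exists>i. is_arg_max (\<lambda>i. \<Sum>j\<in>UNIV. norm (cdot (column i (\<Phi> j)) (column j (R k)))) (\<lambda>_. True) i
             \<and> S (Suc k) = S k \<union> {i}) \<and>
        is_arg_min (\<lambda>Z. norm (phi \<Phi> Z - Y)) (\<lambda>Z. row_supp Z \<subseteq> S (Suc k)) (X (Suc k)) \<and>
        R (Suc k) = Y - phi \<Phi> (X (Suc k)))"

text \<open>
  The residual is measured by \<open>\<rho>\<close> and compared with the tolerance \<open>\<tau>\<close>. The test comes at the end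
  of each iteration, so at least one iteration is performed.
\<close>

definition omp_output ::
  "(complex^'d^'n \<Rightarrow> real) \<Rightarrow> real \<Rightarrow> ('d \<Rightarrow> complex^'m^'n) \<Rightarrow> complex^'d^'n \<Rightarrow> complex^'d^'m \<Rightarrow> bool"
where
  "omp_output \<rho> \<tau> \<Phi> Y Z \<longleftrightarrow>
     (\<exists>S X R K. omp_iterates \<Phi> Y S X R \<and> 1 \<le> K \<and>
        \<rho> (R K) \<le> \<tau> \<and> (\<forall>k. 1 \<le> k \<and> k < K \<longrightarrow> \<not> \<rho> (R k) \<le> \<tau>) \<and> Z = X K)"

end

theory Submission
  imports Defs
begin

text \<open>
  Let \<open>W\<close> be the current error, supported on \<open>supp X\<close>. Unit columns with pairwise inner products at
  most \<open>\<mu>\<close> give a correlation of row \<open>i\<close> with the residual within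
  \<open>\<mu> \<Sum>\<^bsub>k\<noteq>i\<^esub> \<parallel>row\<^sub>k W\<parallel>\<^sub>1 + \<Sum>\<^bsub>j\<^esub> \<parallel>E\<^sub>j\<parallel>\<^sub>2\<close> of \<open>\<parallel>row\<^sub>i W\<parallel>\<^sub>1\<close>. As long as some row of \<open>X\<close> is missing,
  the largest row of \<open>W\<close> is at least \<open>X\<^sub>m\<^sub>i\<^sub>n\<close>, so the sparsity bound makes the largest correlation
  positive and attained only in \<open>supp X\<close>; the residual is orthogonal to the rows already chosen, hence
  each step finds a new row and after \<open>s\<close> steps the support is complete. Conversely the Gershgorin
  estimate \<open>\<parallel>\<Phi>\<^sub>j v\<parallel>\<^sup>2 \<ge> (1 - (s-1)\<mu>)\<parallel>v\<parallel>\<^sup>2\<close> shows that a residual below the tolerance forbids a missing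
  row. The same estimate, applied to the difference of two approximate solutions, gives the error bound.
\<close>

section \<open>Inner products and matrix norms\<close>

lemma cdot_add_right: "cdot u (v + w) = cdot u v + cdot u w"
  by (simp add: cdot_def distrib_left sum.distrib)

lemma cdot_commute: "cdot v u = cnj (cdot u v)"
  by (simp add: cdot_def mult.commute)

lemma cdot_matrix_vector_mult: "cdot u (A *v v) = (\<Sum>k\<in>UNIV. v $ k * cdot u (column k A))"
proof -
  have "cdot u (A *v v) = (\<Sum>l\<in>UNIV. \<Sum>k\<in>UNIV. v $ k * (cnj (u $ l) * column k A $ l))"
    by (simp add: cdot_def matrix_vector_mult_def column_def sum_distrib_left mult_ac)
  also have "\<dots> = (\<Sum>k\<in>UNIV. v $ k * cdot u (column k A))"
    by (subst sum.swap) (simp add: cdot_def sum_distrib_left)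
  finally show ?thesis .
qed

lemma cdot_matrix_vector_mult_left: "cdot (A *v v) u = (\<Sum>k\<in>UNIV. cnj (v $ k) * cdot (column k A) u)"
  unfolding cdot_commute[of "A *v v"] cdot_matrix_vector_mult
  by (simp flip: cdot_commute)

lemma norm_vec_power2: "(norm (v :: complex^'n))\<^sup>2 = (\<Sum>l\<in>UNIV. (norm (v $ l))\<^sup>2)"
  by (simp add: norm_vec_def L2_set_def sum_nonneg)

lemma matrix_vector_mult_axis: "A *v axis i c = c *s column i (A :: 'a::comm_semiring_1^'m^'n)"
  by (simp add: matrix_vector_mult_def axis_def column_def vec_eq_iff if_distrib mult.commute
      cong: if_cong)

lemma cdot_self: "cdot v v = complex_of_real ((norm v)\<^sup>2)"
proof -
  have "cnj z * z = complex_of_real ((norm z)\<^sup>2)" for z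
    by (metis complex_norm_square mult.commute)
  then show ?thesis
    by (simp add: cdot_def norm_vec_power2)
qed

lemma inner_eq_Re_cdot: "(u :: complex^'n) \<bullet> v = Re (cdot u v)"
  by (simp add: inner_vec_def cdot_def inner_complex_def)

lemma norm_cdot_le: "norm (cdot u v) \<le> norm u * norm v"
proof -
  have "norm (cdot u v) \<le> (\<Sum>l\<in>UNIV. norm (u $ l) * norm (v $ l))"
    unfolding cdot_def by (rule sum_norm_le) (simp add: norm_mult)
  also have "\<dots> \<le> norm u * norm v"
    unfolding norm_vec_def using L2_set_mult_ineq[of "\<lambda>l. norm (u $ l)" "\<lambda>l. norm (v $ l)" UNIV] by simp
  finally show ?thesis .
qed

text \<open>The library norm nests by rows; swapping the two sums makes it columnwise, which is how
  \<open>phi\<close> acts.\<close>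

lemma norm_matrix_power2:
  "(norm (M :: complex^'d^'n))\<^sup>2 = (\<Sum>j\<in>UNIV. (norm (column j M))\<^sup>2)"
proof -
  have "(norm M)\<^sup>2 = (\<Sum>l\<in>UNIV. \<Sum>j\<in>UNIV. (norm (M $ l $ j))\<^sup>2)"
    by (simp add: norm_vec_def[of M] L2_set_def sum_nonneg norm_vec_power2)
  also have "\<dots> = (\<Sum>j\<in>UNIV. (norm (column j M))\<^sup>2)"
    by (subst sum.swap) (simp add: norm_vec_power2 column_def)
  finally show ?thesis .
qed

lemma column_component: "column j M $ k = M $ k $ j"
  by (simp add: column_def)

lemma column_add: "column j (M + N) = column j M + column j N"
  and column_diff: "column j (M - N) = column j M - column j (N :: 'a::ab_group_add^'d^'n)"
  by (simp_all add: column_def vec_eq_iff)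

text \<open>Cauchy-Schwarz against the all-ones vector. It supplies the factor \<open>sqrt d\<close>
  between summed column norms and the Frobenius norm, and the factor \<open>card T\<close> in the
  Gershgorin estimate.\<close>

lemma sum_le_sqrt_card:
  fixes f :: "'a \<Rightarrow> real"
  shows "(\<Sum>i\<in>I. f i) \<le> sqrt (card I) * sqrt (\<Sum>i\<in>I. (f i)\<^sup>2)"
proof -
  have "(\<Sum>i\<in>I. f i) \<le> (\<Sum>i\<in>I. \<bar>f i\<bar>)"
    by (rule sum_mono) simp
  also have "\<dots> \<le> sqrt (card I) * sqrt (\<Sum>i\<in>I. (f i)\<^sup>2)"
    using L2_set_mult_ineq[of "\<lambda>_. 1" f I] by (simp add: L2_set_def)
  finally show ?thesis .
qed

lemma sum_col_norms_le: "sum_col_norms (M :: complex^'d^'n) \<le> sqrt (real CARD('d)) * norm M"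
proof -
  have "norm M = sqrt (\<Sum>j\<in>UNIV. (norm (column j M))\<^sup>2)"
    by (metis norm_ge_zero norm_matrix_power2 real_sqrt_abs abs_of_nonneg)
  then show ?thesis
    using sum_le_sqrt_card[of "\<lambda>j. norm (column j M)" UNIV] by (simp add: sum_col_norms_def)
qed

text \<open>Written for \<open>M = phi \<Phi> W\<close> and \<open>N = E\<close>: noise can hide at
  most its own size from the residual.\<close>

lemma sum_col_norms_triangle: "sum_col_norms M \<le> sum_col_norms (M + N) + sum_col_norms N"
proof -
  have "norm (column j M) \<le> norm (column j (M + N)) + norm (column j N)" for j
    using norm_triangle_ineq4[of "column j (M + N)" "column j N"] by (simp add: column_add)
  then show ?thesis
    by (simp add: sum_col_norms_def sum.distrib[symmetric] sum_mono)
qed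

section \<open>Row norms and row support\<close>

lemma l1_row_le_sum_col_norms: "l1_norm (row k W) \<le> sum_col_norms (W :: complex^'d^'m)"
proof -
  have "norm (row k W $ j) \<le> norm (column j W)" for j
    using Finite_Cartesian_Product.norm_nth_le[of "column j W" k] by (simp add: row_def column_def)
  then show ?thesis
    unfolding l1_norm_def sum_col_norms_def by (rule sum_mono)
qed

lemma l1_row_le_norm: "l1_norm (row k W) \<le> sqrt (real CARD('d)) * norm (W :: complex^'d^'m)"
  using l1_row_le_sum_col_norms sum_col_norms_le by (rule order_trans)

lemma l1_norm_row: "l1_norm (row k W) = (\<Sum>j\<in>UNIV. norm (W $ k $ j))"
  by (simp add: l1_norm_def row_def)

lemma l1_norm_pos:
  assumes "v \<noteq> 0"
  shows "0 < l1_norm v"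
proof -
  obtain i where "v $ i \<noteq> 0"
    using assms by (auto simp: vec_eq_iff)
  then show ?thesis
    unfolding l1_norm_def by (intro sum_pos2[of _ i]) auto
qed

lemma row_supp_subset_iff: "row_supp W \<subseteq> T \<longleftrightarrow> (\<forall>k. k \<notin> T \<longrightarrow> (\<forall>j. W $ k $ j = 0))"
  by (auto simp: row_supp_def row_def vec_eq_iff)

lemma row_supp_diff_subset: "row_supp V \<subseteq> T \<Longrightarrow> row_supp W \<subseteq> T \<Longrightarrow> row_supp (V - W) \<subseteq> T"
  by (simp add: row_supp_subset_iff)

lemma min_row_l1_le: "k \<in> row_supp X \<Longrightarrow> min_row_l1 X \<le> l1_norm (row k X)"
  by (simp add: min_row_l1_def)

lemma min_row_l1_pos: "row_supp X \<noteq> {} \<Longrightarrow> 0 < min_row_l1 X"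
  unfolding min_row_l1_def by (subst Min_gr_iff) (auto simp: l1_norm_pos row_supp_def)

section \<open>The measurement map and the coherence of its columns\<close>

lemma column_phi: "column j (phi \<Phi> Z) = \<Phi> j *v column j Z"
  by (simp add: phi_def column_def vec_eq_iff)

lemma phi_diff: "phi \<Phi> (Z - W) = phi \<Phi> Z - phi \<Phi> W"
  by (simp add: phi_def column_diff vec_eq_iff matrix_vector_mult_diff_distrib)

lemma linear_phi: "linear (phi \<Phi>)"
  by (rule linearI)
    (simp_all add: phi_def vec_eq_iff column_def matrix_vector_mult_def distrib_left sum.distrib
      scaleR_sum_right)

lemma norm_cdot_column_le_max_coherence:
  fixes \<Phi> :: "'d::finite \<Rightarrow> complex^'m::finite^'n::finite"
  assumes "\<And>i. norm (column i (\<Phi> j)) = 1" "i \<noteq> k"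
  shows "norm (cdot (column i (\<Phi> j)) (column k (\<Phi> j))) \<le> max_coherence \<Phi>"
proof -
  let ?f = "\<lambda>i k. norm (cdot (column i (\<Phi> j)) (column k (\<Phi> j))) /
     (norm (column i (\<Phi> j)) * norm (column k (\<Phi> j)))"
  have "finite {?f i k | i k. i \<noteq> k}"
    by (rule finite_subset[of _ "range (\<lambda>(i, k). ?f i k)"]) auto
  moreover have "?f i k \<in> {?f i k | i k. i \<noteq> k}"
    using assms(2) by blast
  ultimately have "?f i k \<le> mutual_coherence (\<Phi> j)"
    unfolding mutual_coherence_def by (intro Max_ge) simp_all
  then have "norm (cdot (column i (\<Phi> j)) (column k (\<Phi> j))) \<le> mutual_coherence (\<Phi> j)"
    by (simp add: assms(1))
  also have "\<dots> \<le> max_coherence \<Phi>"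
    by (simp add: max_coherence_def)
  finally show ?thesis .
qed

text \<open>Gershgorin for the Gram matrix: its diagonal is 1 and its other entries are at most
  \<open>\<mu>\<close> in modulus, so the cross terms cost at most \<open>\<mu>\<close> times the
  squared l1 norm of \<open>v\<close> less its diagonal part. Cauchy-Schwarz on \<open>T\<close>
  bounds that l1 norm.\<close>

lemma norm_mult_vector_lower_bound:
  assumes unit: "\<And>i. norm (column i A) = 1"
    and coherent: "\<And>i k. i \<noteq> k \<Longrightarrow> norm (cdot (column i A) (column k A)) \<le> \<mu>"
    and "0 \<le> \<mu>" and supp: "\<And>k. k \<notin> T \<Longrightarrow> v $ k = 0"
  shows "(1 - \<mu> * (real (card T) - 1)) * (norm v)\<^sup>2 \<le> (norm (A *v v))\<^sup>2"
proof -
  let ?n = "\<lambda>k. norm (v $ k)"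
  have restrict: "(\<Sum>k\<in>UNIV. f (?n k)) = (\<Sum>k\<in>T. f (?n k))" if "f 0 = 0" for f :: "real \<Rightarrow> real"
    using that by (intro sum.mono_neutral_right) (auto simp: supp)
  have "cdot (A *v v) (A *v v) = (\<Sum>k\<in>UNIV. \<Sum>i\<in>UNIV. v $ k * cnj (v $ i) * cdot (column i A) (column k A))"
    by (simp add: cdot_matrix_vector_mult cdot_matrix_vector_mult_left sum_distrib_left mult_ac)
  then have "(norm (A *v v))\<^sup>2 =
      (\<Sum>k\<in>UNIV. \<Sum>i\<in>UNIV. Re (v $ k * cnj (v $ i) * cdot (column i A) (column k A)))"
    by (metis (mono_tags, lifting) cdot_self Re_complex_of_real Re_sum sum.cong)
  \<comment> \<open>Subtracting \<open>\<mu> * (?n k * ?n i)\<close> on the diagonal as well turns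
    the double sum into a square; the factor \<open>1 + \<mu>\<close> makes up for it.\<close>
  also have "\<dots> \<ge> (\<Sum>k\<in>UNIV. \<Sum>i\<in>UNIV. (if i = k then (1 + \<mu>) * (?n k)\<^sup>2 else 0) - \<mu> * (?n k * ?n i))"
    (is "_ \<ge> ?L")
  proof (intro sum_mono)
    fix k i
    let ?z = "v $ k * cnj (v $ i) * cdot (column i A) (column k A)"
    show "(if i = k then (1 + \<mu>) * (?n k)\<^sup>2 else 0) - \<mu> * (?n k * ?n i) \<le> Re ?z"
    proof (cases "i = k")
      case True
      then show ?thesis
        by (simp add: cdot_self unit complex_mult_cnj cmod_def power2_eq_square algebra_simps)
    next
      case False
      have "norm ?z \<le> \<mu> * (?n k * ?n i)"
        using mult_right_mono[OF coherent[OF False], of "?n k * ?n i"]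
        by (simp add: norm_mult mult_ac)
      then show ?thesis
        using False abs_Re_le_cmod[of ?z] by simp
    qed
  qed
  also have "?L = (1 + \<mu>) * (\<Sum>k\<in>UNIV. (?n k)\<^sup>2) - \<mu> * (\<Sum>k\<in>UNIV. ?n k)\<^sup>2"
    by (simp add: sum_subtractf sum_distrib_left[symmetric] sum_distrib_right[symmetric] power2_eq_square)
  also have "\<dots> \<ge> (1 + \<mu>) * (\<Sum>k\<in>UNIV. (?n k)\<^sup>2) - \<mu> * (real (card T) * (\<Sum>k\<in>UNIV. (?n k)\<^sup>2))"
  proof -
    have "(\<Sum>k\<in>T. ?n k)\<^sup>2 \<le> real (card T) * (\<Sum>k\<in>T. (?n k)\<^sup>2)"
      using power_mono[OF sum_le_sqrt_card[of ?n T], of 2]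
      by (simp add: sum_nonneg power_mult_distrib)
    then show ?thesis
      using \<open>0 \<le> \<mu>\<close> restrict[of "\<lambda>x. x"] restrict[of "\<lambda>x. x\<^sup>2"] by (simp add: mult_left_mono)
  qed
  finally show ?thesis
    by (simp add: norm_vec_power2[of v] algebra_simps)
qed

section \<open>Least squares on a prescribed row support\<close>

text \<open>Objective and constraint decouple over columns: exchanging column \<open>j\<close> of a
  minimizer for an admissible \<open>v\<close> changes only the \<open>j\<close>th summand of the
  squared Frobenius norm.\<close>

lemma least_squares_columnwise:
  fixes Y :: "complex^'d^'n"
  assumes min: "is_arg_min (\<lambda>Z. norm (phi \<Phi> Z - Y)) (\<lambda>Z. row_supp Z \<subseteq> T) Z"
    and supp: "\<And>k. k \<notin> T \<Longrightarrow> v $ k = 0"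
  shows "norm (column j (Y - phi \<Phi> Z)) \<le> norm (column j Y - \<Phi> j *v v)"
proof -
  define V where "V = (\<chi> k j'. if j' = j then v $ k else Z $ k $ j')"
  have "row_supp Z \<subseteq> T"
    using min by (simp add: is_arg_min_def)
  then have "row_supp V \<subseteq> T"
    using supp by (simp add: row_supp_subset_iff V_def)
  then have "norm (phi \<Phi> Z - Y) \<le> norm (phi \<Phi> V - Y)"
    using min by (auto simp: is_arg_min_linorder)
  then have "(norm (Y - phi \<Phi> Z))\<^sup>2 \<le> (norm (Y - phi \<Phi> V))\<^sup>2"
    by (simp add: norm_minus_commute)
  moreover have col: "column j' V = (if j' = j then v else column j' Z)" for j'
    by (simp add: V_def column_def vec_eq_iff)
  ultimately have "(norm (column j (Y - phi \<Phi> Z)))\<^sup>2 \<le> (norm (column j (Y - phi \<Phi> V)))\<^sup>2"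
    by (simp add: norm_matrix_power2 column_diff column_phi sum.remove[of UNIV j])
  then show ?thesis
    by (simp add: column_diff column_phi col)
qed

text \<open>Otherwise a change of the single entry \<open>(i, j)\<close>, admissible because
  \<open>i \<in> T\<close>, would shorten column \<open>j\<close> of the residual.\<close>

lemma least_squares_residual_orthogonal:
  fixes Y :: "complex^'d^'n"
  assumes unit: "norm (column i (\<Phi> j)) = 1"
    and min: "is_arg_min (\<lambda>Z. norm (phi \<Phi> Z - Y)) (\<lambda>Z. row_supp Z \<subseteq> T) Z" and "i \<in> T"
  shows "cdot (column i (\<Phi> j)) (column j (Y - phi \<Phi> Z)) = 0"
proof -
  define a r where "a = column i (\<Phi> j)" and "r = column j (Y - phi \<Phi> Z)"
  \<comment> \<open>The coefficient \<open>cdot a r\<close> removes from \<open>r\<close> its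
    projection onto the unit vector \<open>a\<close>.\<close>
  define v where "v = column j Z + axis i (cdot a r)"
  have "row_supp Z \<subseteq> T"
    using min by (simp add: is_arg_min_def)
  then have "v $ k = 0" if "k \<notin> T" for k
    using that \<open>i \<in> T\<close> by (auto simp: v_def axis_def column_def row_supp_subset_iff)
  then have "norm r \<le> norm (column j Y - \<Phi> j *v v)"
    unfolding r_def by (rule least_squares_columnwise[OF min])
  also have "column j Y - \<Phi> j *v v = r - cdot a r *s a"
    by (simp add: v_def r_def a_def column_diff column_phi matrix_vector_right_distrib
        matrix_vector_mult_axis)
  finally have "(norm r)\<^sup>2 \<le> (norm (r - cdot a r *s a))\<^sup>2"
    by simp
  \<comment> \<open>With \<open>c = cdot a r\<close> the last two terms become
    \<open>- 2 * |c|^2 + |c|^2\<close>, so minimality forces \<open>c = 0\<close>.\<close>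
  also have "\<dots> = (norm r)\<^sup>2 - 2 * (r \<bullet> (cdot a r *s a)) + (norm (cdot a r *s a))\<^sup>2"
    by (simp add: power2_norm_eq_inner inner_diff inner_commute)
  also have "(norm (cdot a r *s a))\<^sup>2 = (norm (cdot a r))\<^sup>2"
    using unit norm_vec_power2[of a]
    by (simp add: norm_vec_power2 norm_mult power_mult_distrib sum_distrib_left[symmetric] a_def)
  also have "r \<bullet> (cdot a r *s a) = (norm (cdot a r))\<^sup>2"
  proof -
    have "cdot r (c *s a) = c * cdot r a" for c
      by (simp add: cdot_def sum_distrib_left mult_ac)
    then show ?thesis
      by (simp add: inner_eq_Re_cdot cdot_commute[of r a] complex_mult_cnj cmod_def)
  qed
  finally show ?thesis
    by (simp add: a_def r_def)
qed

text \<open>The admissible images form a subspace of a finite-dimensional space, which is closed, so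
  the distance from \<open>Y\<close> is attained there. Working in the image avoids unbounded
  minimizing sequences along the kernel of \<open>phi\<close>.\<close>

lemma ex_least_squares:
  "\<exists>Z. is_arg_min (\<lambda>Z. norm (phi \<Phi> Z - Y)) (\<lambda>Z. row_supp Z \<subseteq> T) (Z :: complex^'d^'m)"
proof -
  let ?F = "{Z :: complex^'d^'m. row_supp Z \<subseteq> T}"
  have "subspace ?F"
    by (simp add: subspace_def row_supp_subset_iff)
  then have "subspace (phi \<Phi> ` ?F)"
    by (rule linear_subspace_image[OF linear_phi])
  then have "closed (phi \<Phi> ` ?F)" "phi \<Phi> ` ?F \<noteq> {}"
    using closed_subspace subspace_0 by blast+
  then obtain V where "V \<in> phi \<Phi> ` ?F" and "\<forall>U\<in>phi \<Phi> ` ?F. dist Y V \<le> dist Y U"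
    by (rule distance_attains_inf[of _ Y]) blast
  then obtain Z where "Z \<in> ?F" and "\<And>V. V \<in> ?F \<Longrightarrow> dist Y (phi \<Phi> Z) \<le> dist Y (phi \<Phi> V)"
    by (elim imageE) simp
  then have "is_arg_min (\<lambda>Z. norm (phi \<Phi> Z - Y)) (\<lambda>Z. row_supp Z \<subseteq> T) Z"
    by (simp add: is_arg_min_linorder dist_norm norm_minus_commute[of Y])
  then show ?thesis ..
qed

section \<open>Runs of the pursuit\<close>

lemma ex_is_arg_max_UNIV:
  fixes f :: "'a::finite \<Rightarrow> 'b::linorder"
  shows "\<exists>i. is_arg_max f (\<lambda>_. True) i"
proof -
  have "Max (range f) \<in> range f"
    by simp
  then obtain i where "Max (range f) = f i"
    by (rule imageE)
  then have "\<forall>k. f k \<le> f i"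
    by (metis Max_ge finite_imageI finite rangeI)
  then show ?thesis
    by (auto simp: is_arg_max_linorder)
qed

text \<open>Dependent choice over triples \<open>(S, X, R)\<close>, as both optimizations may have
  several solutions. This is what keeps statements about all outputs from being vacuous.\<close>

lemma ex_omp_iterates:
  fixes \<Phi> :: "'d::finite \<Rightarrow> complex^'m::finite^'n::finite"
  shows "\<exists>S X R. omp_iterates \<Phi> Y S X R"
proof -
  \<comment> \<open>The choice principle carries an indexed invariant, so the starting value is
    expressed as one that binds only at index 0.\<close>
  let ?init = "\<lambda>k x. k = 0 \<longrightarrow> x = ({}, 0, Y)"
  let ?step = "\<lambda>k (S, X, R) (S', X', R').
     (\<exists>i. is_arg_max (\<lambda>i. \<Sum>j\<in>UNIV. norm (cdot (column i (\<Phi> j)) (column j R))) (\<lambda>_. True) i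
             \<and> S' = S \<union> {i}) \<and>
        is_arg_min (\<lambda>Z. norm (phi \<Phi> Z - Y)) (\<lambda>Z. row_supp Z \<subseteq> S') X' \<and> R' = Y - phi \<Phi> X'"
  have "\<exists>f. \<forall>k. ?init k (f k) \<and> ?step k (f k) (f (Suc k))"
  proof (rule dependent_nat_choice)
    fix x :: "'m set \<times> (complex^'d^'m) \<times> (complex^'d^'n)" and k :: nat
    obtain S X R where x: "x = (S, X, R)"
      by (cases x)
    obtain i where "is_arg_max (\<lambda>i. \<Sum>j\<in>UNIV. norm (cdot (column i (\<Phi> j)) (column j R))) (\<lambda>_. True) i"
      using ex_is_arg_max_UNIV by blast
    moreover obtain Z where
      "is_arg_min (\<lambda>Z. norm (phi \<Phi> Z - Y)) (\<lambda>Z. row_supp Z \<subseteq> S \<union> {i}) Z"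
      using ex_least_squares by blast
    ultimately show "\<exists>y. ?init (Suc k) y \<and> ?step k x y"
      unfolding x by (intro exI[of _ "(S \<union> {i}, Z, Y - phi \<Phi> Z)"]) auto
  qed simp
  then obtain f where "\<forall>k. ?init k (f k) \<and> ?step k (f k) (f (Suc k))" ..
  then have "omp_iterates \<Phi> Y (\<lambda>k. fst (f k)) (\<lambda>k. fst (snd (f k))) (\<lambda>k. snd (snd (f k)))"
    unfolding omp_iterates_def by (simp add: case_prod_unfold)
  then show ?thesis by blast
qed

text \<open>For positive \<open>k\<close> this is the iteration itself. At \<open>k = 0\<close> the
  only matrix of empty support is 0, hence the minimizer, so the selection argument also covers the
  first step.\<close>

lemma omp_iterates_least_squares:
  fixes \<Phi> :: "'d::finite \<Rightarrow> complex^'m::finite^'n::finite"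
  assumes "omp_iterates \<Phi> Y S X R"
  shows "is_arg_min (\<lambda>Z. norm (phi \<Phi> Z - Y)) (\<lambda>Z. row_supp Z \<subseteq> S k) (X k)"
    and "R k = Y - phi \<Phi> (X k)"
proof -
  have "phi \<Phi> 0 = 0"
    using linear_phi by (rule linear_0)
  then show "R k = Y - phi \<Phi> (X k)"
    using assms by (cases k) (auto simp: omp_iterates_def)
  have "row_supp Z \<subseteq> {} \<longleftrightarrow> Z = 0" for Z :: "complex^'d^'m"
    unfolding row_supp_subset_iff by (simp add: vec_eq_iff)
  then have "is_arg_min (\<lambda>Z :: complex^'d^'m. norm (phi \<Phi> Z - Y)) (\<lambda>Z. row_supp Z \<subseteq> {}) 0"
    unfolding is_arg_min_def by simp
  then show "is_arg_min (\<lambda>Z. norm (phi \<Phi> Z - Y)) (\<lambda>Z. row_supp Z \<subseteq> S k) (X k)"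
  proof (cases k)
    case 0
    moreover have "S 0 = {}" "X 0 = 0"
      using assms by (simp_all add: omp_iterates_def)
    ultimately show ?thesis
      using \<open>is_arg_min _ _ 0\<close> by simp
  next
    case (Suc k')
    then show ?thesis
      using assms by (simp add: omp_iterates_def)
  qed
qed

section \<open>Estimates for dictionaries of bounded coherence\<close>

locale coherent_dictionaries =
  fixes \<Phi> :: "'d::finite \<Rightarrow> complex^'m::finite^'n::finite" and \<mu> :: real
  assumes unit: "norm (column i (\<Phi> j)) = 1"
    and coherent: "i \<noteq> k \<Longrightarrow> norm (cdot (column i (\<Phi> j)) (column k (\<Phi> j))) \<le> \<mu>"
    and coherence_nonneg: "0 \<le> \<mu>"
begin

lemma norm_column_phi_lower_bound:
  assumes "row_supp W \<subseteq> T"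
  shows "(1 - \<mu> * (real (card T) - 1)) * (norm (column j W))\<^sup>2 \<le> (norm (column j (phi \<Phi> W)))\<^sup>2"
  unfolding column_phi
  by (rule norm_mult_vector_lower_bound)
    (use assms in \<open>auto simp: unit coherent coherence_nonneg row_supp_subset_iff column_component\<close>)

text \<open>The columnwise Gershgorin estimates add up. The library \<open>sqrt\<close> is odd, so
  taking roots is valid whatever the sign of the factor.\<close>

lemma norm_phi_lower_bound:
  assumes "row_supp W \<subseteq> T"
  shows "sqrt (1 - \<mu> * (real (card T) - 1)) * norm W \<le> norm (phi \<Phi> W)"
proof -
  have "(1 - \<mu> * (real (card T) - 1)) * (norm W)\<^sup>2 \<le> (norm (phi \<Phi> W))\<^sup>2"
    unfolding norm_matrix_power2 sum_distrib_left
    by (intro sum_mono norm_column_phi_lower_bound assms)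
  then show ?thesis
    using real_sqrt_le_mono[of "(1 - \<mu> * (real (card T) - 1)) * (norm W)\<^sup>2"]
    by (fastforce simp: real_sqrt_mult)
qed

lemma sum_col_norms_phi_lower_bound:
  assumes "row_supp W \<subseteq> T"
  shows "sqrt (1 - \<mu> * (real (card T) - 1)) * sum_col_norms W \<le> sum_col_norms (phi \<Phi> W)"
proof -
  have "sqrt (1 - \<mu> * (real (card T) - 1)) * norm (column j W) \<le> norm (column j (phi \<Phi> W))" for j
    using real_sqrt_le_mono[OF norm_column_phi_lower_bound[OF assms, of j]]
    by (simp add: real_sqrt_mult)
  then show ?thesis
    by (simp add: sum_col_norms_def sum_distrib_left sum_mono)
qed

text \<open>In each column the unit diagonal returns the entry \<open>W $ i $ j\<close>, the other
  rows contribute at most \<open>\<mu>\<close> times their entries, and Cauchy-Schwarz bounds the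
  noise. Both directions are used: from below at the largest row of the error, from above off the
  support.\<close>

lemma row_correlation:
  fixes W :: "complex^'d^'m" and E :: "complex^'d^'n"
  assumes "row_supp W \<subseteq> T"
  shows "\<bar>(\<Sum>j\<in>UNIV. norm (cdot (column i (\<Phi> j)) (column j (phi \<Phi> W + E)))) - l1_norm (row i W)\<bar>
    \<le> \<mu> * (\<Sum>k\<in>T - {i}. l1_norm (row k W)) + sum_col_norms E"
proof -
  let ?c = "\<lambda>j. cdot (column i (\<Phi> j)) (column j (phi \<Phi> W + E))"
  have bound: "\<bar>norm (?c j) - norm (W $ i $ j)\<bar>
      \<le> \<mu> * (\<Sum>k\<in>T - {i}. norm (W $ k $ j)) + norm (column j E)" for j
  proof -
    let ?g = "\<lambda>k. W $ k $ j * cdot (column i (\<Phi> j)) (column k (\<Phi> j))"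
    have "?c j = (\<Sum>k\<in>UNIV. ?g k) + cdot (column i (\<Phi> j)) (column j E)"
      by (simp add: column_add column_phi cdot_add_right cdot_matrix_vector_mult column_component)
    also have "(\<Sum>k\<in>UNIV. ?g k) = W $ i $ j + (\<Sum>k\<in>UNIV - {i}. ?g k)"
      by (simp add: sum.remove[of UNIV i] cdot_self unit)
    also have "(\<Sum>k\<in>UNIV - {i}. ?g k) = (\<Sum>k\<in>T - {i}. ?g k)"
      using assms by (intro sum.mono_neutral_right) (auto simp: row_supp_subset_iff)
    finally have "?c j - W $ i $ j = (\<Sum>k\<in>T - {i}. ?g k) + cdot (column i (\<Phi> j)) (column j E)"
      by simp
    moreover have "norm (\<Sum>k\<in>T - {i}. ?g k) \<le> (\<Sum>k\<in>T - {i}. \<mu> * norm (W $ k $ j))"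
      by (intro sum_norm_le)
        (auto simp: norm_mult mult.commute[of \<mu>] intro!: mult_left_mono coherent)
    moreover have "norm (cdot (column i (\<Phi> j)) (column j E)) \<le> norm (column j E)"
      using norm_cdot_le[of "column i (\<Phi> j)" "column j E"] by (simp add: unit)
    ultimately have "norm (?c j - W $ i $ j)
        \<le> \<mu> * (\<Sum>k\<in>T - {i}. norm (W $ k $ j)) + norm (column j E)"
      by (simp add: sum_distrib_left norm_triangle_mono)
    then show ?thesis
      by (rule order_trans[OF norm_triangle_ineq3])
  qed
  have "\<bar>\<Sum>j\<in>UNIV. norm (?c j) - norm (W $ i $ j)\<bar>
      \<le> (\<Sum>j\<in>UNIV. \<mu> * (\<Sum>k\<in>T - {i}. norm (W $ k $ j)) + norm (column j E))"
    by (rule order_trans[OF sum_abs]) (intro sum_mono bound)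
  also have "\<dots> = \<mu> * (\<Sum>k\<in>T - {i}. l1_norm (row k W)) + sum_col_norms E"
    unfolding l1_norm_row sum_col_norms_def sum.distrib sum_distrib_left[symmetric]
    by (subst sum.swap) simp
  finally show ?thesis
    by (simp add: sum_subtractf l1_norm_row)
qed

end

section \<open>Consequences of the noise margin\<close>

text \<open>The assumption \<open>noise_margin\<close> is the sparsity bound multiplied by
  \<open>2 * \<mu> * min_row_l1 X\<close>, which clears all denominators.\<close>

locale sparse_recovery = coherent_dictionaries \<Phi> \<mu>
  for \<Phi> :: "'d::finite \<Rightarrow> complex^'m::finite^'n::finite" and \<mu> :: real +
  fixes X :: "complex^'d^'m" and E Y :: "complex^'d^'n"
  assumes supp_nonempty: "row_supp X \<noteq> {}"
    and Y_eq: "Y = phi \<Phi> X + E"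
    and noise_margin: "2 * (sqrt (real CARD('d)) * norm E)
      < (1 - \<mu> * (2 * real (card (row_supp X)) - 1)) * min_row_l1 X"
begin

abbreviation "s \<equiv> card (row_supp X)"

lemma s_pos: "1 \<le> s"
  using supp_nonempty by (simp add: Suc_le_eq card_gt_0_iff)

lemma margin_pos: "0 < 1 - \<mu> * (2 * real s - 1)"
proof -
  have "0 < (1 - \<mu> * (2 * real s - 1)) * min_row_l1 X"
    using noise_margin by (rule le_less_trans[rotated]) simp
  then show ?thesis
    using min_row_l1_pos[OF supp_nonempty] by (simp add: zero_less_mult_iff)
qed

text \<open>With \<open>x = 1 - \<mu> * (s - 1)\<close> in \<open>(0, 1]\<close> one has
  \<open>x \<le> sqrt x\<close>, and the margin factor is at most \<open>x\<close>. This brings the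
  margin to the constant in the lower bounds for \<open>phi\<close>.\<close>

lemma gershgorin_pos: "0 < 1 - \<mu> * (real s - 1)"
  and gershgorin_sqrt: "1 - \<mu> * (2 * real s - 1) \<le> sqrt (1 - \<mu> * (real s - 1))"
proof -
  let ?x = "1 - \<mu> * (real s - 1)"
  have "\<mu> * (real s - 1) \<le> \<mu> * (2 * real s - 1)"
    using coherence_nonneg by (intro mult_left_mono) auto
  then show pos: "0 < ?x"
    using margin_pos by linarith
  have "?x \<le> 1"
    using coherence_nonneg s_pos by simp
  then have "?x\<^sup>2 \<le> ?x"
    using pos by (simp add: power2_eq_square mult_left_le)
  then have "?x \<le> sqrt ?x"
    by (rule real_le_rsqrt)
  then show "1 - \<mu> * (2 * real s - 1) \<le> sqrt ?x"
    using \<open>\<mu> * (real s - 1) \<le> \<mu> * (2 * real s - 1)\<close> by linarith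
qed

lemma residual_eq: "Y - phi \<Phi> Z = phi \<Phi> (X - Z) + E"
  by (simp add: Y_eq phi_diff)

text \<open>A row of \<open>X\<close> absent from \<open>Z\<close> survives in \<open>X - Z\<close>
  with l1 norm at least \<open>min_row_l1 X\<close>. By the margin its image exceeds twice the noise
  level, and the noise cancels at most half of that.\<close>

lemma missing_row_residual:
  assumes "row_supp Z \<subset> row_supp X"
  shows "norm E < norm (Y - phi \<Phi> Z)"
    and "sqrt (real CARD('d)) * norm E < sum_col_norms (Y - phi \<Phi> Z)"
proof -
  let ?W = "X - Z" and ?g = "sqrt (1 - \<mu> * (real s - 1))"
  have supp: "row_supp ?W \<subseteq> row_supp X"
    using assms by (intro row_supp_diff_subset) auto
  obtain k where k: "k \<in> row_supp X" "k \<notin> row_supp Z"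
    using assms by blast
  then have "row k ?W = row k X"
    by (simp add: row_supp_def row_def vec_eq_iff)
  then have row: "min_row_l1 X \<le> l1_norm (row k ?W)"
    using min_row_l1_le[OF k(1)] by simp
  have "2 * (sqrt (real CARD('d)) * norm E) < ?g * min_row_l1 X"
    using noise_margin gershgorin_sqrt min_row_l1_pos[OF supp_nonempty]
    by (meson less_le_trans less_imp_le mult_right_mono)
  also have "\<dots> \<le> ?g * l1_norm (row k ?W)"
    using row gershgorin_pos by simp
  finally have row_bound: "2 * (sqrt (real CARD('d)) * norm E) < ?g * l1_norm (row k ?W)" .
  also have "\<dots> \<le> ?g * (sqrt (real CARD('d)) * norm ?W)"
    using gershgorin_pos by (simp add: l1_row_le_norm)
  \<comment> \<open>The \<open>sqrt d\<close> of the margin cancels the one from comparing l1 and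
    Frobenius norms.\<close>
  finally have "sqrt (real CARD('d)) * (2 * norm E) < sqrt (real CARD('d)) * (?g * norm ?W)"
    by (simp add: mult_ac)
  then have "2 * norm E < ?g * norm ?W"
    by (subst (asm) mult_less_cancel_left_pos) simp_all
  also note norm_phi_lower_bound[OF supp]
  also have "norm (phi \<Phi> ?W) \<le> norm (Y - phi \<Phi> Z) + norm E"
    using norm_triangle_ineq4[of "phi \<Phi> ?W + E" E] by (simp add: residual_eq)
  finally show "norm E < norm (Y - phi \<Phi> Z)"
    by simp
  \<comment> \<open>Here the row is compared with the summed column norms directly, so
    \<open>sqrt d\<close> stays with the noise and absorbs \<open>sum_col_norms E\<close>.\<close>
  note row_bound
  also have "?g * l1_norm (row k ?W) \<le> ?g * sum_col_norms ?W"
    using gershgorin_pos by (simp add: l1_row_le_sum_col_norms)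
  also note sum_col_norms_phi_lower_bound[OF supp]
  also have "sum_col_norms (phi \<Phi> ?W) \<le> sum_col_norms (Y - phi \<Phi> Z) + sum_col_norms E"
    using sum_col_norms_triangle by (simp add: residual_eq)
  finally show "sqrt (real CARD('d)) * norm E < sum_col_norms (Y - phi \<Phi> Z)"
    using sum_col_norms_le[of E] by simp
qed

text \<open>The largest error row \<open>p\<close> has correlation at least
  \<open>(1 - \<mu> * (s - 1)) * l p - ?e\<close>, rows off the support at most
  \<open>\<mu> * s * l p + ?e\<close>. The gap is positive exactly when
  \<open>2 * ?e < (1 - \<mu> * (2 * s - 1)) * l p\<close>. Rows in \<open>T\<close> have correlation
  0.\<close>

lemma selected_row:
  assumes T: "T \<subset> row_supp X"
    and Z: "is_arg_min (\<lambda>Z. norm (phi \<Phi> Z - Y)) (\<lambda>Z. row_supp Z \<subseteq> T) Z"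
    and i: "is_arg_max (\<lambda>i. \<Sum>j\<in>UNIV. norm (cdot (column i (\<Phi> j)) (column j (Y - phi \<Phi> Z))))
      (\<lambda>_. True) i" (is "is_arg_max ?c _ _")
  shows "i \<in> row_supp X - T"
proof -
  let ?W = "X - Z" and ?e = "sum_col_norms E"
  define l where "l = (\<lambda>k. l1_norm (row k ?W))"
  have Z_supp: "row_supp Z \<subseteq> T"
    using Z by (simp add: is_arg_min_def)
  then have supp: "row_supp ?W \<subseteq> row_supp X"
    using T by (intro row_supp_diff_subset) auto
  have corr: "\<bar>?c k - l k\<bar> \<le> \<mu> * (\<Sum>k'\<in>row_supp X - {k}. l k') + ?e" for k
    using row_correlation[OF supp] by (simp add: residual_eq l_def)
  have "Max (l ` row_supp X) \<in> l ` row_supp X"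
    using supp_nonempty by (intro Max_in) auto
  then obtain p where p: "p \<in> row_supp X" "Max (l ` row_supp X) = l p"
    by (elim imageE)
  have max: "l k \<le> l p" if "k \<in> row_supp X" for k
    using that by (simp flip: p(2))
  have sum_bound: "\<mu> * (\<Sum>k\<in>A. l k) \<le> \<mu> * (real (card A) * l p)" if "A \<subseteq> row_supp X" for A
    using that coherence_nonneg by (intro mult_left_mono sum_bounded_above max) auto
  \<comment> \<open>\<open>p\<close> need not be a missing row, but it dominates one, and
    \<open>Z\<close> leaves missing rows of \<open>X\<close> unchanged.\<close>
  have "min_row_l1 X \<le> l p"
  proof -
    obtain k where k: "k \<in> row_supp X" "k \<notin> T"
      using T by blast
    then have "row k ?W = row k X"
      using Z_supp by (auto simp: row_supp_def row_def vec_eq_iff)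
    then show ?thesis
      using min_row_l1_le[OF k(1)] max[OF k(1)] by (simp add: l_def)
  qed
  then have "(1 - \<mu> * (2 * real s - 1)) * min_row_l1 X \<le> (1 - \<mu> * (2 * real s - 1)) * l p"
    using margin_pos by simp
  then have margin: "2 * ?e < (1 - \<mu> * (2 * real s - 1)) * l p"
    using noise_margin sum_col_norms_le[of E] by linarith
  have "\<mu> * (\<Sum>k\<in>row_supp X - {p}. l k) \<le> \<mu> * ((real s - 1) * l p)"
    using sum_bound[of "row_supp X - {p}"] p(1) s_pos by (simp add: of_nat_diff)
  then have "l p - \<mu> * ((real s - 1) * l p) - ?e \<le> ?c p"
    using corr[of p] by linarith
  also have "?c p \<le> ?c i"
    using i by (simp add: is_arg_max_linorder)
  \<comment> \<open>This threshold is at once the upper bound for rows off the support and a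
    nonnegative number, so it excludes both wrong choices of \<open>i\<close>.\<close>
  finally have ci: "\<mu> * (real s * l p) + ?e < ?c i"
    using margin by (simp add: algebra_simps)
  have "i \<in> row_supp X"
  proof (rule ccontr)
    assume "i \<notin> row_supp X"
    moreover from this supp have "l i = 0"
      by (auto simp: l_def l1_norm_row row_supp_subset_iff)
    ultimately have "?c i \<le> \<mu> * (\<Sum>k\<in>row_supp X. l k) + ?e"
      using corr[of i] by simp
    then show False
      using sum_bound[of "row_supp X"] ci by simp
  qed
  moreover have "i \<notin> T"
  proof
    assume "i \<in> T"
    then have "?c i = 0"
      using least_squares_residual_orthogonal[of i \<Phi> _ Y T Z] Z unit by simp
    moreover have "0 \<le> \<mu> * (real s * l p)" "0 \<le> ?e"
      using coherence_nonneg by (simp_all add: l_def l1_norm_def sum_col_norms_def sum_nonneg)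
    ultimately show False
      using ci by simp
  qed
  ultimately show ?thesis by blast
qed

section \<open>Support recovery by the pursuit\<close>

lemma omp_iterates_support:
  assumes omp: "omp_iterates \<Phi> Y S Z R" and "k \<le> s"
  shows "S k \<subseteq> row_supp X \<and> card (S k) = k"
  using \<open>k \<le> s\<close>
proof (induction k)
  case 0
  then show ?case
    using omp by (simp add: omp_iterates_def)
next
  case (Suc k)
  then have IH: "S k \<subseteq> row_supp X" "card (S k) = k"
    by auto
  then have "S k \<subset> row_supp X"
    using Suc.prems by auto
  obtain i where
    i: "is_arg_max (\<lambda>i. \<Sum>j\<in>UNIV. norm (cdot (column i (\<Phi> j)) (column j (R k)))) (\<lambda>_. True) i"
    and S: "S (Suc k) = S k \<union> {i}"
    using omp unfolding omp_iterates_def by blast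
  have "i \<in> row_supp X - S k"
    using selected_row[OF \<open>S k \<subset> row_supp X\<close> omp_iterates_least_squares(1)[OF omp]] i
    by (simp add: omp_iterates_least_squares(2)[OF omp])
  then show ?case
    using IH S by simp
qed

text \<open>Stated for any measure \<open>\<rho>\<close> and tolerance \<open>\<tau>\<close> to
  serve both stopping rules: \<open>complete\<close> forces a stop by step \<open>s\<close>, where
  the chosen set is the whole support, and \<open>incomplete\<close> excludes stopping with a row
  missing.\<close>

lemma omp_recovers_support:
  assumes incomplete: "\<And>Z. row_supp Z \<subset> row_supp X \<Longrightarrow> \<tau> < \<rho> (Y - phi \<Phi> Z)"
    and complete: "\<And>Z. is_arg_min (\<lambda>Z. norm (phi \<Phi> Z - Y)) (\<lambda>Z. row_supp Z \<subseteq> row_supp X) Z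
      \<Longrightarrow> \<rho> (Y - phi \<Phi> Z) \<le> \<tau>"
  shows "(\<exists>Z. omp_output \<rho> \<tau> \<Phi> Y Z) \<and> (\<forall>Z. omp_output \<rho> \<tau> \<Phi> Y Z \<longrightarrow> row_supp Z = row_supp X)"
proof -
  have stops: "\<rho> (R s) \<le> \<tau>" if omp: "omp_iterates \<Phi> Y S Z R" for S Z R
  proof -
    have "S s = row_supp X"
      using omp_iterates_support[OF omp order_refl] by (simp add: card_subset_eq)
    then show ?thesis
      using complete omp_iterates_least_squares[OF omp, of s] by simp
  qed
  have "\<exists>Z. omp_output \<rho> \<tau> \<Phi> Y Z"
  proof -
    obtain S Z R where omp: "omp_iterates \<Phi> Y S Z R"
      using ex_omp_iterates by blast
    \<comment> \<open>Index 0 is excluded because the test follows an iteration;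
      \<open>s \<ge> 1\<close> provides an admissible index.\<close>
    define K where "K = (LEAST k. 1 \<le> k \<and> \<rho> (R k) \<le> \<tau>)"
    have "1 \<le> K \<and> \<rho> (R K) \<le> \<tau>"
      unfolding K_def by (rule LeastI[of _ s]) (use stops[OF omp] s_pos in simp)
    moreover have "\<not> \<rho> (R k) \<le> \<tau>" if "1 \<le> k" "k < K" for k
      using not_less_Least[of k "\<lambda>k. 1 \<le> k \<and> \<rho> (R k) \<le> \<tau>"] that by (simp add: K_def)
    ultimately have "omp_output \<rho> \<tau> \<Phi> Y (Z K)"
      unfolding omp_output_def using omp by blast
    then show ?thesis ..
  qed
  moreover have "row_supp Z = row_supp X" if "omp_output \<rho> \<tau> \<Phi> Y Z" for Z
  proof -
    obtain S V R K where omp: "omp_iterates \<Phi> Y S V R" and K: "\<rho> (R K) \<le> \<tau>"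
      and first: "\<forall>k. 1 \<le> k \<and> k < K \<longrightarrow> \<not> \<rho> (R k) \<le> \<tau>" and Z: "Z = V K"
      using \<open>omp_output \<rho> \<tau> \<Phi> Y Z\<close> unfolding omp_output_def by blast
    have "K \<le> s"
      using first stops[OF omp] s_pos by (meson not_less)
    then have "row_supp Z \<subseteq> row_supp X"
      using omp_iterates_support[OF omp] omp_iterates_least_squares(1)[OF omp, of K]
      by (auto simp: Z is_arg_min_def)
    moreover have "\<not> \<tau> < \<rho> (Y - phi \<Phi> Z)"
      using K omp_iterates_least_squares(2)[OF omp] by (simp add: Z)
    ultimately show ?thesis
      using incomplete by blast
  qed
  ultimately show ?thesis by blast
qed

text \<open>On the full support \<open>X\<close> itself is a competitor, with residual
  \<open>E\<close>.\<close>

lemma omp_norm_recovers_support: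
  "(\<exists>Z. omp_output norm (norm E) \<Phi> Y Z) \<and>
   (\<forall>Z. omp_output norm (norm E) \<Phi> Y Z \<longrightarrow> row_supp Z = row_supp X)"
proof (rule omp_recovers_support)
  fix Z
  assume "is_arg_min (\<lambda>Z. norm (phi \<Phi> Z - Y)) (\<lambda>Z. row_supp Z \<subseteq> row_supp X) Z"
  then have "norm (phi \<Phi> Z - Y) \<le> norm (phi \<Phi> X - Y)"
    by (simp add: is_arg_min_linorder)
  then show "norm (Y - phi \<Phi> Z) \<le> norm E"
    by (simp add: Y_eq norm_minus_commute[of "phi \<Phi> Z"])
qed (rule missing_row_residual)

text \<open>The lower bound on \<open>\<tau>\<close> ensures the stop, since columnwise minimality
  compares each residual column with that of \<open>E\<close>; the upper bound rules out an early
  one. Cauchy-Schwarz makes the range of \<open>\<tau>\<close> nonempty.\<close>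

lemma omp_sum_col_norms_recovers_support:
  assumes "sum_col_norms E \<le> \<tau>" "\<tau> \<le> sqrt (real CARD('d)) * norm E"
  shows "(\<exists>Z. omp_output sum_col_norms \<tau> \<Phi> Y Z) \<and>
    (\<forall>Z. omp_output sum_col_norms \<tau> \<Phi> Y Z \<longrightarrow> row_supp Z = row_supp X)"
proof (rule omp_recovers_support)
  fix Z
  assume Z: "is_arg_min (\<lambda>Z. norm (phi \<Phi> Z - Y)) (\<lambda>Z. row_supp Z \<subseteq> row_supp X) Z"
  have "norm (column j (Y - phi \<Phi> Z)) \<le> norm (column j E)" for j
  proof -
    have "column j X $ k = 0" if "k \<notin> row_supp X" for k
      using that by (simp add: row_supp_def row_def column_def vec_eq_iff)
    from least_squares_columnwise[OF Z this, of j] show ?thesis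
      by (simp add: Y_eq column_add column_diff column_phi)
  qed
  then have "sum_col_norms (Y - phi \<Phi> Z) \<le> sum_col_norms E"
    by (simp add: sum_col_norms_def sum_mono)
  then show "sum_col_norms (Y - phi \<Phi> Z) \<le> \<tau>"
    using assms(1) by simp
next
  fix Z :: "complex^'d^'m"
  assume "row_supp Z \<subset> row_supp X"
  from missing_row_residual(2)[OF this] show "\<tau> < sum_col_norms (Y - phi \<Phi> Z)"
    using assms(2) by simp
qed

section \<open>Error of constrained least squares\<close>

text \<open>The image of \<open>X - B\<close> is the residual of \<open>B\<close> minus
  \<open>E\<close>, each of norm at most \<open>norm E\<close>; the Gershgorin bound inverts
  \<open>phi\<close> on the support.\<close>

lemma least_squares_error:
  assumes "row_supp B \<subseteq> row_supp X" and "norm (Y - phi \<Phi> B) \<le> norm E"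
  shows "norm (B - X) \<le> 2 * norm E / sqrt (1 - \<mu> * (real s - 1))"
proof -
  have "sqrt (1 - \<mu> * (real s - 1)) * norm (X - B) \<le> norm (phi \<Phi> (X - B))"
    using assms(1) by (intro norm_phi_lower_bound row_supp_diff_subset) auto
  also have "\<dots> \<le> norm (Y - phi \<Phi> B) + norm E"
    using norm_triangle_ineq4[of "phi \<Phi> (X - B) + E" E] by (simp add: residual_eq)
  also have "\<dots> \<le> 2 * norm E"
    using assms(2) by simp
  finally show ?thesis
    using gershgorin_pos by (simp add: field_simps norm_minus_commute)
qed

end

theorem theorem2:
  fixes \<Phi> :: "'d::finite \<Rightarrow> complex^'m::finite^'n::finite"
    and scaleV :: "complex \<Rightarrow> 'v::ab_group_add \<Rightarrow> 'v"
    and L :: "complex^'d^'m \<Rightarrow> 'v"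
    and X :: "complex^'d^'m"
    and E Y :: "complex^'d^'n"
    and s :: nat
    and \<epsilon> :: real
  assumes unit_columns: "\<And>j i. norm (column i (\<Phi> j)) = 1"
    and L_linear: "Vector_Spaces.linear mat_scale scaleV L"
    and L_X: "L X = 0"
    and sparsity: "card (row_supp X) = s"
    and s_pos: "s \<ge> 1"
    and Y_def: "Y = phi \<Phi> X + E"
    and eps_def: "\<epsilon> = norm E"
    and coherence_pos: "max_coherence \<Phi> > 0"
    and s_bound: "real s < 1/2 * (1 + 1 / max_coherence \<Phi>)
                   - sqrt (real CARD('d)) * \<epsilon> / (max_coherence \<Phi> * min_row_l1 X)"
  shows "((\<exists>Z. omp_output norm \<epsilon> \<Phi> Y Z) \<and>
          (\<forall>Z. omp_output norm \<epsilon> \<Phi> Y Z \<longrightarrow> row_supp Z = row_supp X)) \<and>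
         (\<forall>\<tau>. sum_col_norms E \<le> \<tau> \<and> \<tau> \<le> sqrt (real CARD('d)) * \<epsilon> \<longrightarrow>
            (\<exists>Z. omp_output sum_col_norms \<tau> \<Phi> Y Z) \<and>
            (\<forall>Z. omp_output sum_col_norms \<tau> \<Phi> Y Z \<longrightarrow> row_supp Z = row_supp X)) \<and>
         (\<forall>Xhat. is_arg_min (\<lambda>B. norm (Y - phi \<Phi> B))
                   (\<lambda>B. row_supp B \<subseteq> row_supp X \<and> L B = 0) Xhat \<longrightarrow>
            norm (Xhat - X) \<le> 2 * \<epsilon> / sqrt (1 - max_coherence \<Phi> * (real s - 1)))"
proof -
  let ?\<mu> = "max_coherence \<Phi>" and ?e = "sqrt (real CARD('d)) * norm E"
  have nonempty: "row_supp X \<noteq> {}"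
    using sparsity s_pos by auto
  then have pos: "0 < min_row_l1 X"
    by (rule min_row_l1_pos)
  \<comment> \<open>Multiplying by the positive number \<open>?\<mu> * min_row_l1 X\<close> clears
    the denominators and yields the noise margin.\<close>
  have "?\<mu> * min_row_l1 X * real s
      < ?\<mu> * min_row_l1 X * (1/2 * (1 + 1 / ?\<mu>) - ?e / (?\<mu> * min_row_l1 X))"
    using s_bound coherence_pos pos by (intro mult_strict_left_mono) (simp_all add: eps_def)
  also have "\<dots> = (?\<mu> + 1) / 2 * min_row_l1 X - ?e"
    using coherence_pos pos by (simp add: field_simps)
  finally have margin: "2 * ?e < (1 - ?\<mu> * (2 * real (card (row_supp X)) - 1)) * min_row_l1 X"
    by (simp add: sparsity field_simps)
  interpret sparse_recovery \<Phi> ?\<mu> X E Y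
    by unfold_locales
      (simp_all add: coherence_pos less_imp_le nonempty margin Y_def unit_columns
        norm_cdot_column_le_max_coherence)
  have "norm (Xhat - X) \<le> 2 * norm E / sqrt (1 - ?\<mu> * (real s - 1))"
    if "is_arg_min (\<lambda>B. norm (Y - phi \<Phi> B)) (\<lambda>B. row_supp B \<subseteq> row_supp X \<and> L B = 0) Xhat" for Xhat
  proof -
    \<comment> \<open>Since \<open>L X = 0\<close>, the matrix \<open>X\<close> is feasible, so the
      residual of \<open>Xhat\<close> is at most \<open>norm E\<close>.\<close>
    have "row_supp Xhat \<subseteq> row_supp X" and "norm (Y - phi \<Phi> Xhat) \<le> norm (Y - phi \<Phi> X)"
      using that L_X by (auto simp: is_arg_min_linorder)
    then show ?thesis
      using least_squares_error by (simp add: Y_def sparsity)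
  qed
  then show ?thesis
    using omp_norm_recovers_support omp_sum_col_norms_recovers_support
    unfolding eps_def by blast
qed

end
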